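(* Let $G$ be a graph with $n$ vertices and $m\geq 1$ edges, let $\lambda_{1} \geq \lambda_{2} \geq \ldots \geq \lambda_{n}$ be the eigenvalues of its adjacency matrix, and let $E=\sum_{i=1}^{n}|\lambda_{i}|$ be its energy. Then $$ E \geq \frac{2m}{\lambda_{1}}. $$
   Context: Graphs are finite, simple and undirected. The adjacency matrix $A$ of a graph with $n$ vertices is the symmetric $n\times n$ matrix with entries in $\{0,1\}$ whose $(i,j)$ entry is $1$ exactly when vertices $i$ and $j$ are adjacent; its eigenvalues are listed with multiplicity. *)

theory Defs
  imports "Jordan_Normal_Form.Char_Poly"
begin

definition simple_graph :: "'a set \<Rightarrow> 'a set set \<Rightarrow> bool" where
  "simple_graph V E \<longleftrightarrow> finite V \<and> (\<forall>e\<in>E. e \<subseteq> V \<and> card e = 2)"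

text \<open>Rows and columns are indexed (from 0) by an enumeration \<open>vs\<close> of the vertices. The diagonal
  is 0 because \<open>{v, v}\<close> has a single element and so is never an edge of a simple graph.\<close>

definition adjacency_matrix :: "'a list \<Rightarrow> 'a set set \<Rightarrow> real mat" where
  "adjacency_matrix vs E =
     mat (length vs) (length vs) (\<lambda>(i, j). if {vs ! i, vs ! j} \<in> E then 1 else 0)"

text \<open>Real eigenvalues with algebraic multiplicity, in decreasing order. For a symmetric real
  matrix these are all the eigenvalues; see \<open>char_poly_eigenvalues_desc\<close> below.\<close>

definition eigenvalues_desc :: "real mat \<Rightarrow> real list" where
  "eigenvalues_desc A = rev (sorted_list_of_multiset (proots (char_poly A)))"

text \<open>The \<open>i\<close>-th largest eigenvalue, counted from \<open>i = 1\<close>.\<close>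

definition nth_eigenvalue :: "real mat \<Rightarrow> nat \<Rightarrow> real" where
  "nth_eigenvalue A i = eigenvalues_desc A ! (i - 1)"

definition energy :: "real mat \<Rightarrow> real" where
  "energy A = (\<Sum>i = 1..dim_row A. \<bar>nth_eigenvalue A i\<bar>)"

lemma complex_eigenvalue_of_real_symmetric:
  fixes A :: "real mat"
  assumes A: "A \<in> carrier_mat n n"
    and sym: "transpose_mat A = A"
    and ev: "eigenvalue (map_mat complex_of_real A) k"
  shows "k \<in> \<real>"
proof -
  have As: "A $$ (i, j) = A $$ (j, i)" if "i < n" "j < n" for i j
    using A that arg_cong[OF sym, of "\<lambda>M. M $$ (j, i)"] by simp
  from ev obtain v where v: "v \<in> carrier_vec n" "v \<noteq> 0\<^sub>v n"
    and eq: "map_mat complex_of_real A *\<^sub>v v = k \<cdot>\<^sub>v v"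
    using A unfolding eigenvalue_def eigenvector_def by auto
  have comp: "(\<Sum>j<n. of_real (A $$ (i, j)) * v $ j) = k * v $ i" if i: "i < n" for i
    using arg_cong[OF eq, of "\<lambda>w. w $ i"] A v(1) i
    by (simp add: scalar_prod_def atLeast0LessThan)
  define N where "N = (\<Sum>i<n. (cmod (v $ i))\<^sup>2)"
  obtain i0 where i0: "i0 < n" "v $ i0 \<noteq> 0"
    using v by (metis carrier_vecD eq_vecI index_zero_vec(1,2))
  have "0 < (cmod (v $ i0))\<^sup>2" using i0 by simp
  also have "\<dots> \<le> N" unfolding N_def using i0 by (intro member_le_sum) auto
  finally have N: "N > 0" .
  define S where "S = (\<Sum>i<n. \<Sum>j<n. cnj (v $ i) * of_real (A $$ (i, j)) * v $ j)"
  have "S = (\<Sum>i<n. cnj (v $ i) * (k * v $ i))"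
    unfolding S_def by (intro sum.cong refl) (simp add: comp[symmetric] sum_distrib_left mult.assoc)
  also have "\<dots> = k * of_real N"
    unfolding N_def by (simp add: sum_distrib_left complex_norm_square mult_ac del: of_real_power)
  finally have S: "S = k * of_real N" .
  have "cnj S = (\<Sum>i<n. \<Sum>j<n. v $ i * of_real (A $$ (i, j)) * cnj (v $ j))"
    unfolding S_def by simp
  also have "\<dots> = (\<Sum>j<n. \<Sum>i<n. v $ i * of_real (A $$ (i, j)) * cnj (v $ j))"
    by (rule sum.swap)
  also have "\<dots> = S"
    unfolding S_def by (intro sum.cong refl) (simp add: As mult_ac)
  finally have "cnj k * of_real N = k * of_real N" using S by simp
  hence "cnj k = k" using N by simp
  thus ?thesis by (simp add: Reals_cnj_iff)
qed

lemma char_poly_eigenvalues_desc: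
  fixes A :: "real mat"
  assumes A: "A \<in> carrier_mat n n" and sym: "transpose_mat A = A"
  shows "char_poly A = (\<Prod>x\<leftarrow>eigenvalues_desc A. [:- x, 1:])"
    and "length (eigenvalues_desc A) = n"
    and "sorted_wrt (\<ge>) (eigenvalues_desc A)"
    and "set (eigenvalues_desc A) = {k. eigenvalue A k}"
proof -
  let ?C = "map_mat complex_of_real A"
  have C: "?C \<in> carrier_mat n n" using A by simp
  obtain as where as: "char_poly ?C = (\<Prod>a\<leftarrow>as. [:- a, 1:])" "length as = n"
    using char_poly_factorized[OF C] by blast
  have "a \<in> \<real>" if "a \<in> set as" for a
  proof -
    have "poly (char_poly ?C) a = 0"
      using that unfolding as(1) by (simp add: poly_prod_list prod_list_zero_iff o_def image_iff)
    hence "eigenvalue ?C a" using eigenvalue_root_char_poly[OF C] by simp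
    thus ?thesis by (rule complex_eigenvalue_of_real_symmetric[OF A sym])
  qed
  hence *: "map complex_of_real (map Re as) = as"
    by (auto intro!: map_idI simp: o_def)
  interpret h: inj_comm_ring_hom complex_of_real by unfold_locales auto
  interpret p: map_poly_inj_comm_ring_hom complex_of_real ..
  have "map_poly complex_of_real (char_poly A) = (\<Prod>a\<leftarrow>as. [:- a, 1:])"
    using of_real_hom.char_poly_hom[OF A, where 'a = complex] as(1) by simp
  also have "\<dots> = (\<Prod>a\<leftarrow>map complex_of_real (map Re as). [:- a, 1:])"
    unfolding * ..
  also have "\<dots> = map_poly complex_of_real (\<Prod>x\<leftarrow>map Re as. [:- x, 1:])"
    by (simp add: p.hom_prod_list o_def)
  finally have cp: "char_poly A = (\<Prod>x\<leftarrow>map Re as. [:- x, 1:])" by simp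
  have "proots (\<Prod>x\<leftarrow>xs. [:- x, 1:]) = mset xs" for xs :: "real list"
  proof (induction xs)
    case (Cons x xs)
    have "(\<Prod>x\<leftarrow>xs. [:- x, 1:]) \<noteq> 0" by (auto simp: prod_list_zero_iff)
    thus ?case using Cons by (simp add: proots_mult del: mult_pCons_left)
  qed simp
  hence pr: "proots (char_poly A) = mset (map Re as)" unfolding cp by blast
  have ms: "mset (eigenvalues_desc A) = mset (map Re as)"
    unfolding eigenvalues_desc_def pr by simp
  show "length (eigenvalues_desc A) = n"
    using mset_eq_length[OF ms] as(2) by simp
  have "mset (map (\<lambda>x. [:- x, 1:]) (eigenvalues_desc A)) = mset (map (\<lambda>x. [:- x, 1:]) (map Re as))"
    using ms by (metis mset_map)
  thus "char_poly A = (\<Prod>x\<leftarrow>eigenvalues_desc A. [:- x, 1:])"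
    unfolding cp by (metis prod_mset_prod_list)
  show "sorted_wrt (\<ge>) (eigenvalues_desc A)"
    unfolding eigenvalues_desc_def by (simp add: sorted_wrt_rev)
  have "char_poly A \<noteq> 0" using degree_monic_char_poly[OF A] by auto
  thus "set (eigenvalues_desc A) = {k. eigenvalue A k}"
    unfolding eigenvalues_desc_def by (simp add: eigenvalue_root_char_poly[OF A])
qed

lemma adjacency_matrix_symmetric:
  "adjacency_matrix vs E \<in> carrier_mat (length vs) (length vs)"
  "transpose_mat (adjacency_matrix vs E) = adjacency_matrix vs E"
  by (auto simp: adjacency_matrix_def insert_commute intro!: eq_matI)

end

theory Submission
  imports Defs "Jordan_Normal_Form.Schur_Decomposition"
begin

text \<open>The argument uses the eigenvalues \<open>x\<^sub>i\<close> only through their power sums: by Schur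
  triangularization, \<open>tr (A\<^sup>k) = \<Sum>\<^sub>i x\<^sub>i\<^sup>k\<close> for every \<open>k\<close> (\<open>mat_trace_pow\<close>).

  Two facts about an adjacency matrix follow. Counting each edge from both ends gives
  \<open>\<Sum>\<^sub>i x\<^sub>i\<^sup>2 = tr (A\<^sup>2) = 2m\<close>. Moreover the entries of \<open>A\<^sup>k\<close> are nonnegative
  (\<open>pow_mat_nonneg\<close>), so all power sums are nonnegative; an eigenvalue below \<open>-x\<^sub>1\<close> would
  dominate the power sums of large odd exponent and make them negative, hence \<open>\<bar>x\<^sub>i\<bar> \<le> x\<^sub>1\<close> for
  all \<open>i\<close> (\<open>abs_le_of_odd_power_sums_nonneg\<close>). This replaces the usual appeal to
  Perron--Frobenius or to Rayleigh quotients.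

  Therefore \<open>2m = \<Sum>\<^sub>i x\<^sub>i\<^sup>2 \<le> x\<^sub>1 \<Sum>\<^sub>i \<bar>x\<^sub>i\<bar>\<close>, and \<open>x\<^sub>1 > 0\<close> because \<open>m \<ge> 1\<close>.\<close>

text \<open>The trace of a square matrix, as the sum of the diagonal entries.\<close>

definition mat_trace :: "'a::comm_ring_1 mat \<Rightarrow> 'a" where
  "mat_trace A = (\<Sum>i<dim_row A. A $$ (i, i))"

lemma mat_trace_mult:
  assumes "A \<in> carrier_mat n k" "B \<in> carrier_mat k n"
  shows "mat_trace (A * B) = (\<Sum>i<n. \<Sum>j<k. A $$ (i, j) * B $$ (j, i))"
  using assms by (auto simp: mat_trace_def scalar_prod_def atLeast0LessThan intro!: sum.cong)

lemma mat_trace_mult_commute: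
  assumes "A \<in> carrier_mat n k" "B \<in> carrier_mat k n"
  shows "mat_trace (A * B) = mat_trace (B * A)"
  unfolding mat_trace_mult[OF assms] mat_trace_mult[OF assms(2,1)]
  by (subst sum.swap) (simp add: mult.commute)

lemma mat_trace_similar:
  assumes "similar_mat_wit A B P Q"
  shows "mat_trace A = mat_trace B"
proof -
  define n where "n = dim_row A"
  have car: "A \<in> carrier_mat n n" "B \<in> carrier_mat n n" "P \<in> carrier_mat n n" "Q \<in> carrier_mat n n"
    and QP: "Q * P = 1\<^sub>m n" and A: "A = P * B * Q"
    using similar_mat_witD[OF n_def assms] by blast+
  have "mat_trace A = mat_trace (Q * (P * B))"
    unfolding A using car by (intro mat_trace_mult_commute[of _ n n]) auto
  also have "Q * (P * B) = Q * P * B"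
    using car by (intro assoc_mult_mat[symmetric]) auto
  also have "\<dots> = B" using car QP by simp
  finally show ?thesis .
qed

lemma upper_triangular_pow:
  fixes B :: "'a::comm_ring_1 mat"
  assumes B: "B \<in> carrier_mat n n" and ut: "upper_triangular B"
  shows "(\<forall>i<n. \<forall>j<i. (B ^\<^sub>m k) $$ (i, j) = 0) \<and> (\<forall>i<n. (B ^\<^sub>m k) $$ (i, i) = B $$ (i, i) ^ k)"
proof (induction k)
  case 0
  then show ?case using B by auto
next
  case (Suc k)
  have C: "B ^\<^sub>m k \<in> carrier_mat n n" using B by simp
  have entry: "(B ^\<^sub>m Suc k) $$ (i, j) = (\<Sum>l<n. (B ^\<^sub>m k) $$ (i, l) * B $$ (l, j))"
    if "i < n" "j < n" for i j
    using B C that by (simp add: scalar_prod_def atLeast0LessThan)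
  have zero: "(B ^\<^sub>m k) $$ (i, l) * B $$ (l, j) = 0"
    if "i < n" "l < n" "l < i \<or> j < l" for i l j
    using that Suc.IH B upper_triangularD[OF ut, of j l] by auto
  have "(B ^\<^sub>m Suc k) $$ (i, j) = 0" if "i < n" "j < i" for i j
    unfolding entry[OF that(1) order.strict_trans[OF that(2,1)]]
    using that by (intro sum.neutral ballI zero) auto
  moreover have "(B ^\<^sub>m Suc k) $$ (i, i) = B $$ (i, i) ^ Suc k" if i: "i < n" for i
  proof -
    have "(B ^\<^sub>m Suc k) $$ (i, i) = (\<Sum>l\<in>{i}. (B ^\<^sub>m k) $$ (i, l) * B $$ (l, i))"
      unfolding entry[OF i i] using i by (intro sum.mono_neutral_right ballI zero) auto
    then show ?thesis using Suc.IH i by (simp add: mult.commute)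
  qed
  ultimately show ?case by blast
qed

lemma mat_trace_pow:
  fixes A :: "'a::conjugatable_ordered_field mat"
  assumes A: "A \<in> carrier_mat n n" and cp: "char_poly A = (\<Prod>e\<leftarrow>es. [:- e, 1:])"
  shows "mat_trace (A ^\<^sub>m k) = (\<Sum>i<n. (es ! i) ^ k)"
proof -
  obtain B P Q where "schur_decomposition A es = (B, P, Q)"
    by (cases "schur_decomposition A es") auto
  from schur_decomposition[OF A cp this]
  have sim: "similar_mat_wit A B P Q" and ut: "upper_triangular B" and dg: "diag_mat B = es"
    by auto
  have B: "B \<in> carrier_mat n n" using similar_mat_witD2[OF A sim] by simp
  have "mat_trace (A ^\<^sub>m k) = mat_trace (B ^\<^sub>m k)"
    by (rule mat_trace_similar[OF similar_mat_wit_pow[OF sim]])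
  also have "\<dots> = (\<Sum>i<n. (es ! i) ^ k)"
    using upper_triangular_pow[OF B ut, of k] B unfolding dg[symmetric]
    by (auto simp: mat_trace_def diag_mat_def intro!: sum.cong)
  finally show ?thesis .
qed

lemma pow_mat_nonneg:
  fixes A :: "real mat"
  assumes A: "A \<in> carrier_mat n n" and nonneg: "\<And>i j. i < n \<Longrightarrow> j < n \<Longrightarrow> 0 \<le> A $$ (i, j)"
  shows "i < n \<Longrightarrow> j < n \<Longrightarrow> 0 \<le> (A ^\<^sub>m k) $$ (i, j)"
proof (induction k arbitrary: i j)
  case 0
  then show ?case using A by auto
next
  case (Suc k)
  have "A ^\<^sub>m k \<in> carrier_mat n n" using A by simp
  then show ?case using A Suc nonneg
    by (auto simp: scalar_prod_def intro!: sum_nonneg mult_nonneg_nonneg)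
qed

text \<open>If some \<open>x\<^sub>j = -r\<close> had \<open>r > c := max 0 M\<close>, then for odd \<open>k\<close> the power sum would be at most
  \<open>-r\<^sup>k + |I| c\<^sup>k\<close>, which is negative for large \<open>k\<close>. Taking the maximum with 0 also covers \<open>M < 0\<close>.\<close>

lemma abs_le_of_odd_power_sums_nonneg:
  fixes x :: "'i \<Rightarrow> real"
  assumes fin: "finite I" and pow: "\<And>k. odd k \<Longrightarrow> 0 \<le> (\<Sum>i\<in>I. x i ^ k)"
    and M: "\<And>i. i \<in> I \<Longrightarrow> x i \<le> M" and j: "j \<in> I"
  shows "\<bar>x j\<bar> \<le> M"
proof (rule ccontr)
  assume "\<not> \<bar>x j\<bar> \<le> M"
  then have neg: "x j < 0" "M < - x j" using M[OF j] by auto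
  define r where "r = - x j"
  define c where "c = max 0 M"
  have r: "0 < r" "0 \<le> c" "c < r" using neg by (auto simp: r_def c_def)
  have "(\<lambda>k. real (card I) * (c / r) ^ k) \<longlonglongrightarrow> real (card I) * 0"
    using r by (intro tendsto_mult tendsto_const LIMSEQ_realpow_zero) auto
  then have "\<forall>\<^sub>F k in sequentially. real (card I) * (c / r) ^ k < 1"
    by (intro order_tendstoD(2)) auto
  then obtain K where K: "\<And>k. k \<ge> K \<Longrightarrow> real (card I) * (c / r) ^ k < 1"
    unfolding eventually_sequentially by blast
  define k where "k = 2 * K + 1"
  have odd: "odd k" and kK: "k \<ge> K" by (auto simp: k_def)
  have lt: "real (card I) * c ^ k < r ^ k"
    using K[OF kK] r by (simp add: power_divide field_simps)
  have "(\<Sum>i\<in>I. x i ^ k) = x j ^ k + (\<Sum>i\<in>I - {j}. x i ^ k)"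
    by (rule sum.remove[OF fin j])
  also have "\<dots> \<le> - (r ^ k) + (\<Sum>i\<in>I - {j}. c ^ k)"
    using odd M by (intro add_mono sum_mono power_mono_odd) (auto simp: r_def c_def le_max_iff_disj)
  also have "(\<Sum>i\<in>I - {j}. c ^ k) \<le> (\<Sum>i\<in>I. c ^ k)"
    using fin r by (intro sum_mono2) auto
  finally have "(\<Sum>i\<in>I. x i ^ k) < 0" using lt by simp
  then show False using pow[OF odd] by simp
qed

theorem corollary3p2:
  fixes V :: "'a set" and E :: "'a set set" and vs :: "'a list" and m :: nat
  assumes "simple_graph V E"
    and "set vs = V" and "distinct vs"
    and "m = card E" and "m \<ge> 1"
  shows "energy (adjacency_matrix vs E) \<ge> 2 * real m / nth_eigenvalue (adjacency_matrix vs E) 1"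
proof -
  define A where "A = adjacency_matrix vs E"
  define n where "n = length vs"
  \<comment> \<open>Indexed from 0, so \<open>x 0\<close> is the largest eigenvalue.\<close>
  define x where "x i = eigenvalues_desc A ! i" for i
  have A: "A \<in> carrier_mat n n" and sym: "transpose_mat A = A"
    unfolding A_def n_def by (rule adjacency_matrix_symmetric)+
  note ev = char_poly_eigenvalues_desc[OF A sym]
  have tr: "mat_trace (A ^\<^sub>m k) = (\<Sum>i<n. x i ^ k)" for k
    unfolding x_def by (rule mat_trace_pow[OF A ev(1)])
  have squares: "(\<Sum>i<n. (x i)\<^sup>2) = 2 * real m"
  proof -
    have finE: "finite E"
      using assms(1,2) by (intro finite_subset[of E "Pow (set vs)"]) (auto simp: simple_graph_def)
    \<comment> \<open>\<open>S e\<close> consists of the two ordered pairs of indices of the ends of \<open>e\<close>.\<close>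
    define S where "S e = {p \<in> {..<n} \<times> {..<n}. {vs ! fst p, vs ! snd p} = e}" for e
    have card_S: "card (S e) = 2" if e: "e \<in> E" for e
    proof -
      have "card e = 2" "e \<subseteq> set vs" using assms(1,2) e by (auto simp: simple_graph_def)
      then obtain a b where ab: "e = {a, b}" "a \<noteq> b" "a \<in> set vs" "b \<in> set vs"
        by (auto simp: card_2_iff)
      then obtain i j where ij: "i < n" "j < n" "vs ! i = a" "vs ! j = b"
        unfolding n_def by (metis in_set_conv_nth)
      have "S e = {(i, j), (j, i)}"
        using ab(1) ij assms(3) unfolding S_def n_def by (auto simp: doubleton_eq_iff nth_eq_iff_index_eq)
      moreover have "i \<noteq> j" using ij ab(2) by blast
      ultimately show ?thesis by simp
    qed
    have "A ^\<^sub>m 2 = A * A" using A by (simp add: numeral_2_eq_2)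
    then have "(\<Sum>i<n. (x i)\<^sup>2) = (\<Sum>i<n. \<Sum>j<n. A $$ (i, j) * A $$ (j, i))"
      using mat_trace_mult[OF A A] tr[of 2] by simp
    also have "\<dots> = (\<Sum>i<n. \<Sum>j<n. if {vs ! i, vs ! j} \<in> E then 1 else 0)"
      unfolding n_def by (intro sum.cong refl) (auto simp: A_def adjacency_matrix_def insert_commute)
    also have "\<dots> = (\<Sum>p\<in>{..<n} \<times> {..<n}. if {vs ! fst p, vs ! snd p} \<in> E then 1 else 0)"
      by (simp add: sum.cartesian_product case_prod_unfold)
    also have "\<dots> = real (card {p \<in> {..<n} \<times> {..<n}. {vs ! fst p, vs ! snd p} \<in> E})"
      by (simp add: sum.If_cases Int_def)
    also have "{p \<in> {..<n} \<times> {..<n}. {vs ! fst p, vs ! snd p} \<in> E} = (\<Union>e\<in>E. S e)"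
      by (auto simp: S_def)
    also have "card \<dots> = (\<Sum>e\<in>E. card (S e))"
      by (intro card_UN_disjoint finE) (auto simp: S_def)
    finally show ?thesis using card_S \<open>m = card E\<close> by simp
  qed
  have pow: "0 \<le> (\<Sum>i<n. x i ^ k)" for k
  proof -
    have "0 \<le> (A ^\<^sub>m k) $$ (i, i)" if "i < n" for i
      by (rule pow_mat_nonneg[OF A _ that that]) (simp add: A_def n_def adjacency_matrix_def)
    then show ?thesis
      unfolding tr[symmetric] mat_trace_def using A by (auto intro!: sum_nonneg)
  qed
  have le_x0: "x i \<le> x 0" if "i < n" for i
    using sorted_wrt_nth_less[OF ev(3), of 0 i] that ev(2) by (cases "i = 0") (auto simp: x_def)
  have abs_le: "\<bar>x i\<bar> \<le> x 0" if "i < n" for i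
    using that le_x0 pow by (intro abs_le_of_odd_power_sums_nonneg[of "{..<n}"]) auto
  have "x 0 > 0"
  proof (rule ccontr)
    assume "\<not> x 0 > 0"
    then have "x i = 0" if "i < n" for i using abs_le[OF that] by linarith
    then show False using squares \<open>m \<ge> 1\<close> by simp
  qed
  have "2 * real m = (\<Sum>i<n. \<bar>x i\<bar> * \<bar>x i\<bar>)"
    unfolding squares[symmetric] by (simp add: power2_eq_square)
  also have "\<dots> \<le> (\<Sum>i<n. x 0 * \<bar>x i\<bar>)"
    using abs_le by (intro sum_mono mult_right_mono) auto
  also have "\<dots> = energy A * x 0"
  proof -
    have "energy A = (\<Sum>i<n. \<bar>x i\<bar>)"
      using A by (simp add: energy_def nth_eigenvalue_def x_def sum.atLeast1_atMost_eq)
    then show ?thesis by (simp add: sum_distrib_left mult.commute)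
  qed
  finally have "2 * real m / x 0 \<le> energy A"
    using \<open>x 0 > 0\<close> by (simp add: divide_le_eq)
  then show ?thesis by (simp add: A_def x_def nth_eigenvalue_def)
qed

end
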